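(* There are uncountably many transcendental entire functions $f:\mathbb{C}\to\mathbb{C}$, $f(z)=\sum_{n=0}^{\infty}a_nz^n$, with rational coefficients $a_n\in\mathbb{Q}$ for all $n\ge 0$, such that $f(\overline{\mathbb{Q}})\subseteq\overline{\mathbb{Q}}$ and $f^{-1}(\overline{\mathbb{Q}})\subseteq\overline{\mathbb{Q}}$. That is, the set of all such functions $f$ is uncountable.
   Context: $\overline{\mathbb{Q}}\subseteq\mathbb{C}$ denotes the field of algebraic numbers (the algebraic closure of $\mathbb{Q}$ in $\mathbb{C}$). $f(\overline{\mathbb{Q}})$ is the image of $\overline{\mathbb{Q}}$ under $f$, and $f^{-1}(\overline{\mathbb{Q}})=\{z\in\mathbb{C}: f(z)\in\overline{\mathbb{Q}}\}$ is the full preimage. An entire function is a function holomorphic on all of $\mathbb{C}$. A function $f$ is transcendental if the only polynomial $P\in\mathbb{C}[X,Y]$ satisfying $P(z,f(z))=0$ for all $z$ in the domain of $f$ is the zero polynomial. *)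

theory Defs
  imports "HOL-Complex_Analysis.Complex_Analysis" "HOL-Computational_Algebra.Polynomial"
begin

definition Qbar :: "complex set" where
  "Qbar = {z. algebraic z}"

(* Bivariate polynomials are elements of C[X][Y]: the coefficients of the outer polynomial
   in Y are polynomials in X, so poly (poly P [:w:]) z is the value P(z, w). *)
definition transcendental_on :: "complex set \<Rightarrow> (complex \<Rightarrow> complex) \<Rightarrow> bool" where
  "transcendental_on D f \<longleftrightarrow>
     (\<forall>P :: complex poly poly. (\<forall>z\<in>D. poly (poly P [:f z:]) z = 0) \<longrightarrow> P = 0)"

end

theory Submission
  imports Defs "HOL-Computational_Algebra.Fundamental_Theorem_Algebra"
begin

text \<open>The function is the limit of rational polynomials \<^term>\<open>F m\<close>. Let \<^term>\<open>g 0\<close>,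
  \<^term>\<open>g 1\<close>, ... enumerate the nonzero rational polynomials, and let \<^term>\<open>F (Suc m)\<close> be
  \<^term>\<open>F m\<close> plus a tiny rational multiple of a power of the variable times
  \<^term>\<open>\<Prod>j\<le>m. pcompose (g j) (F m) * g j\<close>. For a root \<^term>\<open>\<alpha>\<close> of \<^term>\<open>g j\<close>, the value at
  \<^term>\<open>\<alpha>\<close> is frozen from step \<^term>\<open>j\<close> on, and it is algebraic. Moreover
  \<^term>\<open>F m - [:\<alpha>:]\<close> divides \<^term>\<open>pcompose (g j) (F m)\<close>, so each later step multiplies
  \<^term>\<open>F m - [:\<alpha>:]\<close> by a factor close to 1 on the disc of radius \<^term>\<open>m\<close>; hence in this disc the
  limit takes the value \<^term>\<open>\<alpha>\<close> only at the roots of the rational polynomial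
  \<^term>\<open>pcompose (g j) (F m)\<close>. Since the scaling of each step is free up to smallness, the Taylor
  coefficients can be made to differ from any given sequence of coefficient sequences.\<close>

subsection \<open>Polynomials with rational coefficients\<close>

text \<open>Coefficients stay in the ambient field, so such a polynomial can be evaluated and
  composed there without an embedding.\<close>

definition rational_poly :: "'a :: field_char_0 poly \<Rightarrow> bool" where
  "rational_poly p \<longleftrightarrow> (\<forall>i. coeff p i \<in> \<rat>)"

lemma rational_poly_monom: "c \<in> \<rat> \<Longrightarrow> rational_poly (monom c n)"
  by (simp add: rational_poly_def coeff_monom)

lemma rational_poly_pCons: "c \<in> \<rat> \<Longrightarrow> rational_poly p \<Longrightarrow> rational_poly (pCons c p)"
  by (auto simp: rational_poly_def coeff_pCons split: nat.splits)

lemma rational_poly_pConsD: "rational_poly (pCons c p) \<Longrightarrow> c \<in> \<rat> \<and> rational_poly p"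
  unfolding rational_poly_def by (metis coeff_pCons_0 coeff_pCons_Suc)

lemma rational_poly_add: "rational_poly p \<Longrightarrow> rational_poly q \<Longrightarrow> rational_poly (p + q)"
  by (simp add: rational_poly_def)

lemma rational_poly_smult: "c \<in> \<rat> \<Longrightarrow> rational_poly p \<Longrightarrow> rational_poly (smult c p)"
  by (simp add: rational_poly_def)

lemma rational_poly_mult: "rational_poly p \<Longrightarrow> rational_poly q \<Longrightarrow> rational_poly (p * q)"
  by (auto simp: rational_poly_def coeff_mult intro!: Rats_sum)

lemma rational_poly_1: "rational_poly 1"
  using rational_poly_monom[of 1 0] by (simp add: one_pCons monom_0)

lemma rational_poly_0: "rational_poly 0"
  by (simp add: rational_poly_def)

lemma rational_poly_power: "rational_poly p \<Longrightarrow> rational_poly (p ^ n)"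
  by (induction n) (auto intro: rational_poly_1 rational_poly_mult)

lemma rational_poly_prod: "(\<And>x. x \<in> A \<Longrightarrow> rational_poly (f x)) \<Longrightarrow> rational_poly (prod f A)"
  by (induction A rule: infinite_finite_induct) (auto intro: rational_poly_1 rational_poly_mult)

lemma rational_poly_pcompose:
  "rational_poly p \<Longrightarrow> rational_poly q \<Longrightarrow> rational_poly (pcompose p q)"
proof (induction p)
  case (pCons a p)
  then show ?case
    using rational_poly_pConsD[OF pCons.prems(1)]
    by (auto simp: pcompose_pCons intro!: rational_poly_add rational_poly_mult
          rational_poly_pCons rational_poly_0)
qed (auto intro: rational_poly_0)

lemma algebraic_iff_rational_poly:
  "algebraic x \<longleftrightarrow> (\<exists>p. rational_poly p \<and> p \<noteq> 0 \<and> poly p x = 0)"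
  by (simp add: algebraic_altdef rational_poly_def)

lemma countable_rational_polys: "countable {p :: 'a :: field_char_0 poly. rational_poly p}"
proof -
  have "inj_on coeffs {p :: 'a poly. rational_poly p}"
    by (simp add: inj_on_def coeffs_eq_iff)
  moreover have "coeffs ` {p :: 'a poly. rational_poly p} \<subseteq> lists \<rat>"
    by (auto simp: rational_poly_def coeffs_def lists_eq_set)
  moreover have "countable (lists (\<rat> :: 'a set))"
    by (intro countable_lists) (simp add: Rats_def)
  ultimately show ?thesis
    by (metis countable_image_inj_on countable_subset)
qed

text \<open>The powers of \<^term>\<open>poly p \<alpha>\<close> lie in the rational vector space generated by the
  powers of \<^term>\<open>\<alpha>\<close>, which has finite dimension.\<close>

lemma algebraic_poly:
  fixes \<alpha> :: "'a :: field_char_0"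
  assumes alg: "algebraic \<alpha>" and p: "rational_poly p"
  shows "algebraic (poly p \<alpha>)"
proof -
  interpret vs: vector_space "\<lambda>(q::rat) (z::'a). of_rat q * z"
    by unfold_locales (auto simp: algebra_simps of_rat_add of_rat_mult)
  obtain g where g: "rational_poly g" "g \<noteq> 0" "poly g \<alpha> = 0"
    using alg by (auto simp: algebraic_iff_rational_poly)
  define n where "n = degree g"
  define T where "T = (\<lambda>i. \<alpha> ^ i) ` {..<n}"
  have scale: "c * x \<in> vs.span T" if "c \<in> \<rat>" "x \<in> vs.span T" for c x
    using that vs.span_scale by (metis Rats_cases)
  have pow: "\<alpha> ^ i \<in> vs.span T" for i
  proof (induction i rule: less_induct)
    case (less i)
    show ?case
    proof (cases "i < n")
      case True
      then show ?thesis by (auto simp: T_def intro: vs.span_base)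
    next
      case False
      \<comment> \<open>Solving \<open>poly g \<alpha> = 0\<close> for the top power and multiplying
        by \<open>\<alpha> ^ (i - n)\<close> reduces \<open>\<alpha> ^ i\<close> to smaller
        powers.\<close>
      have lc: "coeff g n \<noteq> 0" using g by (simp add: n_def)
      have "(\<Sum>j<n. coeff g j * \<alpha> ^ j) + coeff g n * \<alpha> ^ n = 0"
        using g(3) by (simp add: poly_altdef n_def lessThan_Suc_atMost[symmetric])
      hence "\<alpha> ^ n = (\<Sum>j<n. - (coeff g j / coeff g n) * \<alpha> ^ j)"
        using lc by (simp add: field_simps sum_negf sum_divide_distrib[symmetric] add_eq_0_iff)
      hence "\<alpha> ^ (i - n) * \<alpha> ^ n = (\<Sum>j<n. - (coeff g j / coeff g n) * \<alpha> ^ (i - n + j))"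
        by (simp add: sum_distrib_left power_add mult_ac)
      hence "\<alpha> ^ i = (\<Sum>j<n. - (coeff g j / coeff g n) * \<alpha> ^ (i - n + j))"
        using False by (simp flip: power_add)
      also have "\<dots> \<in> vs.span T"
        using less False g(1)
        by (intro vs.span_sum scale) (auto simp: rational_poly_def)
      finally show ?thesis .
    qed
  qed
  have poly_span: "poly q \<alpha> \<in> vs.span T" if "rational_poly q" for q
    using that by (auto simp: poly_altdef rational_poly_def intro!: vs.span_sum scale pow)
  define w where "w = poly p \<alpha>"
  have w: "w ^ k \<in> vs.span T" for k
    using poly_span[OF rational_poly_power[OF p, of k]] by (simp add: w_def poly_power)
  \<comment> \<open>Linear dependence of the set of powers of \<open>w\<close> yields a polynomial
    only if distinct exponents give distinct elements; two coinciding powers give a binomial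
    relation directly.\<close>
  show ?thesis
  proof (cases "inj_on (\<lambda>k. w ^ k) {..n}")
    case False
    then obtain i j where ij: "i \<noteq> j" "w ^ i = w ^ j" by (auto simp: inj_on_def)
    have "rational_poly (monom (1::'a) i + smult (-1) (monom 1 j))"
      by (intro rational_poly_add rational_poly_smult rational_poly_monom) auto
    moreover have "coeff (monom (1::'a) i + smult (-1) (monom 1 j)) i \<noteq> 0"
      using ij by simp
    hence "monom (1::'a) i + smult (-1) (monom 1 j) \<noteq> 0" by (metis coeff_0)
    ultimately show ?thesis
      using ij unfolding w_def[symmetric] algebraic_iff_rational_poly
      by (intro exI[of _ "monom (1::'a) i + smult (-1) (monom 1 j)"]) (auto simp: poly_monom)
  next
    case True
    let ?S = "(\<lambda>k. w ^ k) ` {..n}"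
    have "card T \<le> n" unfolding T_def using card_image_le[of "{..<n}"] by fastforce
    moreover have "card ?S = Suc n" using card_image[OF True] by simp
    moreover have "finite T" "?S \<subseteq> vs.span T" using w by (auto simp: T_def)
    ultimately have "vs.dependent ?S"
      using vs.independent_span_bound[of T ?S] by linarith
    then obtain u where u: "\<exists>v\<in>?S. u v \<noteq> 0" "(\<Sum>v\<in>?S. of_rat (u v) * v) = 0"
      using vs.dependent_finite[of ?S] by auto
    define q where "q = (\<Sum>k\<le>n. monom (of_rat (u (w ^ k)) :: 'a) k)"
    have cq: "coeff q k = (if k \<le> n then of_rat (u (w ^ k)) else 0)" for k
      by (simp add: q_def coeff_sum)
    have "rational_poly q" by (simp add: rational_poly_def cq)
    moreover have "q \<noteq> 0" using u(1) cq by (metis (no_types, lifting) imageE atMost_iff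
          coeff_0 of_rat_eq_0_iff)
    moreover have "poly q w = 0"
      using u(2) by (simp add: sum.reindex[OF True] q_def poly_sum poly_monom)
    ultimately show ?thesis
      unfolding w_def[symmetric] algebraic_iff_rational_poly by blast
  qed
qed

subsection \<open>Entire power series and transcendence\<close>

text \<open>The second part makes the coefficients a function of \<open>f\<close>: this is used both
  to show a series terminates and to diagonalise over functions.\<close>

lemma everywhere_convergent_power_series:
  fixes f :: "complex \<Rightarrow> complex"
  assumes "\<And>z. (\<lambda>n. a n * z ^ n) sums f z"
  shows "f holomorphic_on UNIV" and "(deriv ^^ n) f 0 / fact n = a n"
proof -
  have r: "fps_conv_radius (Abs_fps a) = \<infinity>"
    unfolding fps_conv_radius_def using assms
    by (intro conv_radius_inftyI'') (auto simp: sums_iff)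
  have f: "f = eval_fps (Abs_fps a)"
    using assms by (auto simp: eval_fps_def sums_iff)
  show "f holomorphic_on UNIV"
    unfolding f by (intro holomorphic_on_eval_fps) (simp add: r)
  have "f has_fps_expansion Abs_fps a"
    unfolding f by (rule eval_fps_has_fps_expansion) (simp add: r)
  from fps_nth_fps_expansion[OF this, of n] show "(deriv ^^ n) f 0 / fact n = a n"
    by simp
qed

lemma poly_growth_bound:
  fixes p :: "complex poly"
  shows "\<exists>B\<ge>0. \<forall>z. norm z \<ge> 1 \<longrightarrow> norm (poly p z) \<le> B * norm z ^ degree p"
proof (intro exI conjI allI impI)
  show "(\<Sum>i\<le>degree p. norm (coeff p i)) \<ge> 0" by (simp add: sum_nonneg)
  fix z :: complex assume z: "norm z \<ge> 1"
  have "norm (poly p z) \<le> (\<Sum>i\<le>degree p. norm (coeff p i) * norm z ^ i)"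
    by (simp add: poly_altdef norm_mult[symmetric] norm_power[symmetric] norm_sum
          del: norm_mult norm_power)
  also have "\<dots> \<le> (\<Sum>i\<le>degree p. norm (coeff p i) * norm z ^ degree p)"
    using z by (intro sum_mono mult_left_mono power_increasing) auto
  finally show "norm (poly p z) \<le> (\<Sum>i\<le>degree p. norm (coeff p i)) * norm z ^ degree p"
    by (simp add: sum_distrib_right)
qed

text \<open>Meant for the leading coefficient in Y of an algebraic relation, by which the relation
  is divided for large \<open>z\<close>.\<close>

lemma poly_bounded_away_from_0:
  fixes p :: "complex poly"
  assumes "p \<noteq> 0"
  shows "\<exists>c>0. \<exists>r. \<forall>z. norm z \<ge> r \<longrightarrow> norm (poly p z) \<ge> c"
proof (cases p)
  case (pCons a q)
  show ?thesis
  proof (cases "q = 0")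
    case True
    then show ?thesis using assms pCons by (intro exI[of _ "norm a"]) auto
  next
    case False
    then show ?thesis using poly_infinity[OF False, of 1 a] pCons zero_less_one by blast
  qed
qed

text \<open>Cauchy's root bound: once \<open>norm w > 1\<close>, every lower power is at most
  \<open>norm w ^ (d - 1)\<close>. Only the lower bound \<open>c\<close> on the leading coefficient
  enters, so the estimate is uniform in \<open>z\<close> when the \<open>p i\<close> depend on
  \<open>z\<close>.\<close>

lemma norm_root_le:
  fixes p :: "nat \<Rightarrow> complex"
  assumes d: "d > 0" and root: "(\<Sum>i\<le>d. p i * w ^ i) = 0" and c: "c > 0" "norm (p d) \<ge> c"
  shows "norm w \<le> 1 + (\<Sum>i<d. norm (p i)) / c"
proof (cases "norm w \<le> 1")
  case True
  moreover have "(\<Sum>i<d. norm (p i)) / c \<ge> 0" using c by (simp add: sum_nonneg)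
  ultimately show ?thesis by linarith
next
  case False
  hence w: "norm w > 1" by simp
  have "p d * w ^ d = - (\<Sum>i<d. p i * w ^ i)"
    using root by (simp add: lessThan_Suc_atMost[symmetric] add_eq_0_iff2 add.commute)
  hence "norm (p d) * norm w ^ d \<le> (\<Sum>i<d. norm (p i * w ^ i))"
    by (metis norm_minus_cancel norm_mult norm_power norm_sum)
  also have "\<dots> = (\<Sum>i<d. norm (p i) * norm w ^ i)"
    by (simp add: norm_mult norm_power)
  also have "\<dots> \<le> (\<Sum>i<d. norm (p i) * norm w ^ (d - 1))"
    using w by (intro sum_mono mult_left_mono power_increasing) auto
  finally have "norm (p d) * norm w * norm w ^ (d - 1) \<le> (\<Sum>i<d. norm (p i)) * norm w ^ (d - 1)"
    using d by (simp add: sum_distrib_right power_eq_if mult_ac split: if_splits)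
  hence "norm (p d) * norm w \<le> (\<Sum>i<d. norm (p i))"
    using w by (meson mult_le_cancel_right_pos zero_less_power less_trans zero_less_one)
  moreover have "c * norm w \<le> norm (p d) * norm w"
    using c by (intro mult_right_mono) auto
  ultimately have "norm w * c \<le> (\<Sum>i<d. norm (p i))" by (simp add: mult.commute)
  hence "norm w \<le> (\<Sum>i<d. norm (p i)) / c" using c by (simp add: pos_le_divide_eq)
  thus ?thesis by simp
qed

text \<open>An algebraic entire function has polynomial growth, so it is a polynomial by Liouville.\<close>

lemma transcendental_onI:
  assumes f: "\<And>z. (\<lambda>n. a n * z ^ n) sums f z" and inf: "infinite {n. a n \<noteq> 0}"
  shows "transcendental_on UNIV f"
  unfolding transcendental_on_def
proof (intro allI impI)
  fix P :: "complex poly poly"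
  assume "\<forall>z\<in>UNIV. poly (poly P [:f z:]) z = 0"
  hence root: "(\<Sum>i\<le>degree P. poly (coeff P i) z * f z ^ i) = 0" for z
    by (simp add: poly_altdef[of P] poly_sum poly_power)
  define d where "d = degree P"
  show "P = 0"
  proof (rule ccontr)
    assume "P \<noteq> 0"
    hence lc: "coeff P d \<noteq> 0" by (simp add: d_def)
    have d: "d > 0"
    proof (rule ccontr)
      assume "\<not> d > 0"
      hence "poly (coeff P d) z = 0" for z using root[of z] by (simp add: d_def)
      thus False using lc poly_all_0_iff_0 by blast
    qed
    obtain c r where c: "c > 0" and r: "\<And>z. norm z \<ge> r \<Longrightarrow> norm (poly (coeff P d) z) \<ge> c"
      using poly_bounded_away_from_0[OF lc] by blast
    have "\<forall>i. \<exists>B\<ge>0. \<forall>z. norm z \<ge> 1 \<longrightarrow>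
        norm (poly (coeff P i) z) \<le> B * norm z ^ degree (coeff P i)"
      using poly_growth_bound by blast
    then obtain B where B: "\<And>i. B i \<ge> 0"
        "\<And>i z. norm z \<ge> 1 \<Longrightarrow> norm (poly (coeff P i) z) \<le> B i * norm z ^ degree (coeff P i)"
      by metis
    \<comment> \<open>A crude common bound for the degrees of all lower coefficients.\<close>
    define N where "N = (\<Sum>i<d. degree (coeff P i))"
    have bound: "norm (f z) \<le> (1 + (\<Sum>i<d. B i) / c) * norm z ^ N" if z: "norm z \<ge> max 1 r" for z
    proof -
      have "(\<Sum>i<d. norm (poly (coeff P i) z)) \<le> (\<Sum>i<d. B i * norm z ^ N)"
      proof (intro sum_mono)
        fix i assume i: "i \<in> {..<d}"
        have "norm (poly (coeff P i) z) \<le> B i * norm z ^ degree (coeff P i)"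
          using B z by simp
        also have "\<dots> \<le> B i * norm z ^ N"
          using z i B(1) by (intro mult_left_mono power_increasing) (auto simp: N_def intro: member_le_sum)
        finally show "norm (poly (coeff P i) z) \<le> B i * norm z ^ N" .
      qed
      hence "(\<Sum>i<d. norm (poly (coeff P i) z)) / c \<le> ((\<Sum>i<d. B i) * norm z ^ N) / c"
        using c by (intro divide_right_mono) (auto simp: sum_distrib_right)
      moreover have "norm (f z) \<le> 1 + (\<Sum>i<d. norm (poly (coeff P i) z)) / c"
        using root[of z] z c r[of z] d by (intro norm_root_le) (auto simp: d_def)
      moreover have "1 \<le> norm z ^ N" using z by simp
      ultimately show ?thesis by (simp add: algebra_simps)
    qed
    have "f \<xi> = (\<Sum>k\<le>N. (deriv ^^ k) f 0 / fact k * \<xi> ^ k)" for \<xi>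
      using everywhere_convergent_power_series(1)[OF f] bound by (rule Liouville_polynomial)
    hence eq: "f \<xi> = (\<Sum>k\<le>N. a k * \<xi> ^ k)" for \<xi>
      by (simp add: everywhere_convergent_power_series(2)[OF f])
    \<comment> \<open>The series and its truncation both represent \<open>f\<close>, so uniqueness
      of coefficients kills all terms beyond \<open>N\<close>.\<close>
    have "(\<lambda>n. (if n \<le> N then a n else 0) * \<xi> ^ n) sums f \<xi>" for \<xi>
      unfolding eq using sums_If_finite[of "\<lambda>n. n \<le> N" "\<lambda>n. a n * \<xi> ^ n"]
      by (simp add: if_distrib if_distribR atMost_def cong: if_cong)
    from everywhere_convergent_power_series(2)[OF this]
    have "a n = (if n \<le> N then a n else 0)" for n
      by (simp add: everywhere_convergent_power_series(2)[OF f])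
    hence "{n. a n \<noteq> 0} \<subseteq> {..N}" by (metis (mono_tags, lifting) atMost_iff mem_Collect_eq subsetI)
    thus False using inf finite_subset by blast
  qed
qed

subsection \<open>Perturbing a rational polynomial\<close>

text \<open>Each quotient of \<open>T\<close> by \<open>p - [:\<alpha>:]\<close> is bounded on the
  disc, and finitely many \<alpha> allow one constant. A small multiple of \<open>T\<close> is then
  small relative to the distance of \<open>p\<close> from each \<alpha>.\<close>

lemma poly_multiple_bound:
  fixes p T :: "complex poly"
  assumes "finite A" and dvd: "\<And>\<alpha>. \<alpha> \<in> A \<Longrightarrow> (p - [:\<alpha>:]) dvd T"
  shows "\<exists>B>0. \<forall>\<alpha>\<in>A. \<forall>z. norm z \<le> r \<longrightarrow> norm (poly T z) \<le> B * norm (poly p z - \<alpha>)"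
proof -
  have "\<forall>\<alpha>\<in>A. \<exists>b>0. \<forall>z. norm z \<le> r \<longrightarrow> norm (poly T z) \<le> b * norm (poly p z - \<alpha>)"
  proof
    fix \<alpha> assume "\<alpha> \<in> A"
    then obtain S where S: "T = (p - [:\<alpha>:]) * S" using dvd by (auto elim: dvdE)
    obtain b where b: "b > 0" "\<And>z. norm z \<le> r \<Longrightarrow> norm (poly S z) \<le> b"
      using poly_bound_exists[of r S] by blast
    have "norm (poly T z) \<le> b * norm (poly p z - \<alpha>)" if "norm z \<le> r" for z
      using mult_right_mono[OF b(2)[OF that], of "norm (poly p z - \<alpha>)"]
      by (simp add: S norm_mult mult.commute)
    with b(1) show "\<exists>b>0. \<forall>z. norm z \<le> r \<longrightarrow> norm (poly T z) \<le> b * norm (poly p z - \<alpha>)"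
      by blast
  qed
  then obtain b where b: "\<And>\<alpha>. \<alpha> \<in> A \<Longrightarrow> b \<alpha> > 0"
      "\<And>\<alpha> z. \<alpha> \<in> A \<Longrightarrow> norm z \<le> r \<Longrightarrow> norm (poly T z) \<le> b \<alpha> * norm (poly p z - \<alpha>)"
    by metis
  \<comment> \<open>The summand 1 keeps the constant positive when \<open>A\<close> is
    empty.\<close>
  have le: "b \<alpha> \<le> 1 + sum b A" if "\<alpha> \<in> A" for \<alpha>
    using member_le_sum[of \<alpha> A b] that b(1) assms(1) by (force simp: less_imp_le)
  have "1 + sum b A > 0" using b(1) by (simp add: sum_nonneg add_pos_nonneg less_imp_le)
  moreover have "norm (poly T z) \<le> (1 + sum b A) * norm (poly p z - \<alpha>)"
    if "\<alpha> \<in> A" "norm z \<le> r" for \<alpha> z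
    using b(2)[OF that] mult_right_mono[OF le[OF that(1)], of "norm (poly p z - \<alpha>)"] by simp
  ultimately show ?thesis by blast
qed

text \<open>Composition with \<open>p\<close> is multiplicative and sends the linear factor X -
  \<alpha> of \<open>g\<close> to \<open>p - [:\<alpha>:]\<close>.\<close>

lemma diff_const_dvd_pcompose:
  fixes g p :: "'a :: field poly"
  assumes "poly g \<alpha> = 0"
  shows "(p - [:\<alpha>:]) dvd pcompose g p"
proof -
  obtain h where "g = [:-\<alpha>, 1:] * h" using assms by (auto simp: poly_eq_0_iff_dvd elim: dvdE)
  moreover have "pcompose [:-\<alpha>, 1:] p = p - [:\<alpha>:]"
    by (simp add: pcompose_pCons)
  ultimately show ?thesis by (metis dvd_triv_left pcompose_mult)
qed

text \<open>The perturbation is a multiple both of \<^term>\<open>g j\<close>, which preserves the values at the roots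
  of \<^term>\<open>g j\<close>, and of \<^term>\<open>pcompose (g j) p\<close>, which is itself a multiple of
  \<^term>\<open>p - [:\<alpha>:]\<close> for every root \<^term>\<open>\<alpha>\<close> of \<^term>\<open>g j\<close>.\<close>

lemma perturbation_exists:
  fixes p :: "complex poly" and g :: "nat \<Rightarrow> complex poly" and a :: "nat \<Rightarrow> complex"
  assumes p: "rational_poly p" "degree p > 0" "\<And>i. norm (coeff p i) \<le> 1 / fact i"
    and g: "\<And>j. rational_poly (g j)" "\<And>j. g j \<noteq> 0"
  shows "\<exists>q. rational_poly q \<and> degree p < degree q \<and> (\<forall>i. norm (coeff q i) \<le> 1 / fact i) \<and>
    (\<forall>i\<le>degree p. coeff q i = coeff p i) \<and>
    (\<forall>j\<le>m. \<forall>\<alpha>. poly (g j) \<alpha> = 0 \<longrightarrow> poly q \<alpha> = poly p \<alpha>) \<and>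
    (\<forall>j\<le>m. \<forall>\<alpha>. poly (g j) \<alpha> = 0 \<longrightarrow> (\<forall>z. norm z \<le> real m \<longrightarrow>
       norm (poly q z - poly p z) \<le> norm (poly p z - \<alpha>) / (real m + 2)\<^sup>2)) \<and>
    coeff q (degree q) \<noteq> a (degree q)"
proof -
  define h where "h = (\<Prod>j\<le>m. pcompose (g j) p * g j)"
  \<comment> \<open>The monomial pushes the perturbation above degree \<open>degree p\<close>, so
    existing coefficients survive and the degree grows.\<close>
  define T where "T = monom 1 (Suc (degree p)) * h"
  define A where "A = (\<Union>j\<le>m. {\<alpha>. poly (g j) \<alpha> = 0})"
  define D where "D = degree T"
  have h_dvd: "pcompose (g j) p * g j dvd h" if "j \<le> m" for j
    unfolding h_def using that by (intro dvd_prodI) auto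
  have T_rat: "rational_poly T"
    unfolding T_def h_def using p g
    by (intro rational_poly_mult rational_poly_monom rational_poly_prod rational_poly_pcompose) auto
  have "pcompose (g j) p \<noteq> 0" for j
    using g(2) p(2) pcompose_eq_0 by blast
  hence h0: "h \<noteq> 0" using g(2) by (simp add: h_def)
  have T0: "T \<noteq> 0" and D: "D > degree p"
    using h0 by (auto simp: T_def D_def degree_mult_eq monom_eq_0_iff degree_monom_eq)
  have coeff_T: "coeff T i = 0" if "i \<le> degree p" for i
    using that by (simp add: T_def coeff_monom_mult)
  have T_root: "poly T \<alpha> = 0" if "j \<le> m" "poly (g j) \<alpha> = 0" for j \<alpha>
  proof -
    have "g j dvd T" unfolding T_def using h_dvd[OF that(1)] dvd_mult dvd_mult_right by blast
    thus ?thesis using that(2) by (auto elim!: dvdE)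
  qed
  have "(p - [:\<alpha>:]) dvd T" if \<alpha>: "\<alpha> \<in> A" for \<alpha>
  proof -
    obtain j where j: "j \<le> m" "poly (g j) \<alpha> = 0" using \<alpha> unfolding A_def by blast
    have "(p - [:\<alpha>:]) dvd pcompose (g j) p" by (rule diff_const_dvd_pcompose) fact
    also have "\<dots> dvd h" using h_dvd[OF j(1)] dvd_mult_left by blast
    finally show ?thesis unfolding T_def by (rule dvd_mult)
  qed
  moreover have "finite A" unfolding A_def using g(2) by (auto intro: poly_roots_finite)
  ultimately obtain B where B: "B > 0"
      "\<And>\<alpha> z. \<alpha> \<in> A \<Longrightarrow> norm z \<le> real m \<Longrightarrow> norm (poly T z) \<le> B * norm (poly p z - \<alpha>)"
    using poly_multiple_bound[of A p T "real m"] by blast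
  define C where "C = (\<Sum>i\<le>D. norm (coeff T i) * fact i)"
  have C: "norm (coeff T i) * fact i \<le> C" for i
  proof (cases "i \<le> D")
    case True
    then show ?thesis unfolding C_def by (intro member_le_sum) auto
  next
    case False
    then show ?thesis by (simp add: C_def D_def coeff_eq_0 sum_nonneg)
  qed
  \<comment> \<open>\<open>T\<close> will be divided by \<open>K\<close> or \<open>Suc K\<close>:
    \<open>C\<close> secures the factorial bounds, the last term the relative estimate.\<close>
  obtain K :: nat where K: "real K \<ge> 1 + C + B * (real m + 2)\<^sup>2"
    using real_arch_simple by blast
  have "C \<ge> 0" by (simp add: C_def sum_nonneg)
  hence K': "real K > 0" "real K \<ge> C" "real K \<ge> B * (real m + 2)\<^sup>2"
    using K mult_nonneg_nonneg[OF less_imp_le[OF B(1)] zero_le_power2[of "real m + 2"]]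
    by linarith+
  have lc: "coeff T D \<noteq> 0" using T0 by (simp add: D_def)
  \<comment> \<open>Two consecutive scalings give different leading coefficients, so at least one
    avoids \<open>a D\<close>.\<close>
  have "coeff T D / of_nat K \<noteq> a D \<or> coeff T D / of_nat (Suc K) \<noteq> a D"
  proof (rule ccontr)
    assume "\<not> ?thesis"
    hence "coeff T D / of_nat K = coeff T D / of_nat (Suc K)" by simp
    hence "of_nat (Suc K) = (of_nat K :: complex)"
      using lc K'(1) by (simp add: frac_eq_eq del: of_nat_Suc)
    thus False by (simp only: of_nat_eq_iff)
  qed
  then obtain k where k: "k \<ge> K" "coeff T D / of_nat k \<noteq> a D" by (metis le_Suc_eq order_refl)
  have k': "real k > 0" "real k \<ge> C" "real k \<ge> B * (real m + 2)\<^sup>2"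
    using K' of_nat_mono[OF k(1), where ?'a = real] by linarith+
  define q where "q = p + smult (1 / of_nat k) T"
  have deg: "degree q = D"
    unfolding q_def using D k'(1) by (subst degree_add_eq_right) (auto simp: D_def)
  have "rational_poly q"
    unfolding q_def using p T_rat by (intro rational_poly_add rational_poly_smult) auto
  moreover have "degree p < degree q" using deg D by simp
  moreover have "norm (coeff q i) \<le> 1 / fact i" for i
  proof (cases "i \<le> degree p")
    case True
    then show ?thesis using p(3) by (simp add: q_def coeff_T)
  next
    case False
    have "norm (coeff T i) * fact i \<le> real k" using C[of i] k'(2) by linarith
    hence "norm (coeff T i) / real k \<le> 1 / fact i"
      using k'(1) by (simp add: field_simps)
    then show ?thesis using False by (simp add: q_def coeff_eq_0 norm_divide)
  qed
  moreover have "coeff q i = coeff p i" if "i \<le> degree p" for i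
    using that by (simp add: q_def coeff_T)
  moreover have "poly q \<alpha> = poly p \<alpha>" if "j \<le> m" "poly (g j) \<alpha> = 0" for j \<alpha>
    using T_root[OF that] by (simp add: q_def)
  moreover have "norm (poly q z - poly p z) \<le> norm (poly p z - \<alpha>) / (real m + 2)\<^sup>2"
    if "j \<le> m" "poly (g j) \<alpha> = 0" "norm z \<le> real m" for j \<alpha> z
  proof -
    have "\<alpha> \<in> A" using that by (auto simp: A_def)
    hence "norm (poly T z) \<le> B * norm (poly p z - \<alpha>)" using B(2) that(3) by blast
    hence "(real m + 2)\<^sup>2 * norm (poly T z) \<le> (real m + 2)\<^sup>2 * (B * norm (poly p z - \<alpha>))"
      by (intro mult_left_mono) auto
    also have "\<dots> \<le> real k * norm (poly p z - \<alpha>)"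
      using mult_right_mono[OF k'(3), of "norm (poly p z - \<alpha>)"] by (simp add: mult_ac)
    finally have "norm (poly T z) / real k \<le> norm (poly p z - \<alpha>) / (real m + 2)\<^sup>2"
      using k'(1) by (simp add: field_simps)
    thus ?thesis by (simp add: q_def norm_divide)
  qed
  moreover have "coeff q (degree q) \<noteq> a (degree q)"
    using k(2) D by (simp add: deg) (simp add: q_def coeff_eq_0)
  ultimately show ?thesis by blast
qed

text \<open>The infinite product of the factors \<^term>\<open>1 - 1 / (real k + 2)\<^sup>2\<close> telescopes.\<close>

lemma half_le_of_slow_decrease:
  fixes u :: "nat \<Rightarrow> real"
  assumes nonneg: "\<And>k. u k \<ge> 0"
    and dec: "\<And>k. k \<ge> m \<Longrightarrow> u (Suc k) \<ge> u k - u k / (real k + 2)\<^sup>2" and "k \<ge> m"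
  shows "u k \<ge> u m / 2"
proof -
  \<comment> \<open>Since 1 - 1/(k+2)^2 = (k+1)(k+3)/(k+2)^2, weighting \<open>u k\<close> by
    (k+1)/(k+2), which lies between 1/2 and 1, gives a nondecreasing sequence.\<close>
  have "u k * (real k + 1) / (real k + 2) \<ge> u m * (real m + 1) / (real m + 2)"
    using \<open>k \<ge> m\<close>
  proof (induction k rule: dec_induct)
    case (step k)
    have "u k * (real k + 1) / (real k + 2)
        = (u k - u k / (real k + 2)\<^sup>2) * ((real k + 2) / (real k + 3))"
      by (simp add: divide_simps) (simp add: algebra_simps power2_eq_square)
    also have "\<dots> \<le> u (Suc k) * ((real k + 2) / (real k + 3))"
      using step by (intro mult_right_mono dec) auto
    finally show ?case using step by (simp add: add_ac)
  qed simp
  moreover have "u m / 2 \<le> u m * (real m + 1) / (real m + 2)"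
    using nonneg[of m] by (simp add: field_simps)
  moreover have "u k * (real k + 1) / (real k + 2) \<le> u k"
    using nonneg[of k] by (simp add: field_simps)
  ultimately show ?thesis by linarith
qed

section \<open>Construction of the function as a limit\<close>

text \<open>\<open>A\<close> is an arbitrary countable list of coefficient sequences; escaping every
  such list is what uncountability needs.\<close>

lemma exists_function_preserving_Qbar:
  fixes A :: "nat \<Rightarrow> nat \<Rightarrow> complex"
  shows "\<exists>(f :: complex \<Rightarrow> complex) a. (\<forall>n. a n \<in> \<rat>) \<and> (\<forall>z. (\<lambda>n. a n * z ^ n) sums f z) \<and>
    infinite {n. a n \<noteq> 0} \<and> f ` Qbar \<subseteq> Qbar \<and> f -` Qbar \<subseteq> Qbar \<and> (\<forall>k. a \<noteq> A k)"
proof -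
  define G where "G = {p :: complex poly. rational_poly p \<and> p \<noteq> 0}"
  define g where "g = from_nat_into G"
  have "countable G"
    unfolding G_def by (rule countable_subset[OF _ countable_rational_polys]) auto
  moreover have "1 \<in> G" by (simp add: G_def rational_poly_1)
  ultimately have range_g: "range g = G"
    unfolding g_def by (intro range_from_nat_into) auto
  hence g: "rational_poly (g j)" "g j \<noteq> 0" for j by (auto simp: G_def)
  have Qbar_iff: "\<alpha> \<in> Qbar \<longleftrightarrow> (\<exists>j. poly (g j) \<alpha> = 0)" for \<alpha>
  proof -
    have "\<alpha> \<in> Qbar \<longleftrightarrow> (\<exists>q\<in>range g. poly q \<alpha> = 0)"
      unfolding range_g by (auto simp: Qbar_def algebraic_iff_rational_poly G_def)
    thus ?thesis by auto
  qed

  \<comment> \<open>Positive degree keeps the compositions \<open>pcompose (g j) p\<close> nonzero;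
    the factorial bound makes the limit series converge everywhere.\<close>
  define Inv where "Inv p \<longleftrightarrow> rational_poly p \<and> degree p > 0 \<and> (\<forall>i. norm (coeff p i) \<le> 1 / fact i)"
    for p :: "complex poly"
  define Step where "Step m p q \<longleftrightarrow> degree p < degree q \<and>
    (\<forall>i\<le>degree p. coeff q i = coeff p i) \<and>
    (\<forall>j\<le>m. \<forall>\<alpha>. poly (g j) \<alpha> = 0 \<longrightarrow> poly q \<alpha> = poly p \<alpha>) \<and>
    (\<forall>j\<le>m. \<forall>\<alpha>. poly (g j) \<alpha> = 0 \<longrightarrow> (\<forall>z. norm z \<le> real m \<longrightarrow>
       norm (poly q z - poly p z) \<le> norm (poly p z - \<alpha>) / (real m + 2)\<^sup>2)) \<and>
    coeff q (degree q) \<noteq> A m (degree q)" for m and p q :: "complex poly"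
  have "\<exists>F. \<forall>m. Inv (F m) \<and> Step m (F m) (F (Suc m))"
  proof (rule dependent_nat_choice)
    have "rational_poly [:0, 1 :: complex:]"
      by (intro rational_poly_pCons rational_poly_0) auto
    moreover have "norm (coeff [:0, 1 :: complex:] i) \<le> 1 / fact i" for i
      by (auto simp: coeff_pCons split: nat.splits)
    ultimately show "\<exists>p. Inv p" unfolding Inv_def by (intro exI[of _ "[:0, 1:]"]) simp
  next
    fix p m assume "Inv p"
    thus "\<exists>q. Inv q \<and> Step m p q"
      using perturbation_exists[of p g m "A m"] g unfolding Inv_def Step_def
      by (metis (no_types, lifting) gr_implies_not0 not_gr_zero)
  qed
  then obtain F where F: "\<And>m. Inv (F m)" "\<And>m. Step m (F m) (F (Suc m))" by blast
  have mono: "strict_mono (\<lambda>m. degree (F m))"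
    using F(2) by (intro strict_monoI_Suc) (simp add: Step_def)
  have deg_gt: "degree (F m) \<ge> m" for m
    using strict_mono_imp_increasing[OF mono] by simp
  have stable: "coeff (F k) i = coeff (F m) i" if "i \<le> degree (F m)" "k \<ge> m" for i k m
    using that(2)
  proof (induction k rule: dec_induct)
    case (step k)
    have "degree (F m) \<le> degree (F k)" using monoD[OF strict_mono_mono[OF mono], of m k] step by simp
    thus ?case using F(2)[of k] that(1) step by (simp add: Step_def)
  qed simp

  \<comment> \<open>\<open>F i\<close> has degree at least \<open>i\<close>, so its coefficient at
    \<open>i\<close> is already final.\<close>
  define a where "a i = coeff (F i) i" for i
  have a_eq: "a i = coeff (F m) i" if "i \<le> degree (F m)" for i m
    using stable[of i m "max i m"] stable[of i i "max i m"] that deg_gt[of i] by (simp add: a_def)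
  have a_bound: "norm (a i) \<le> 1 / fact i" for i
    using F(1)[of i] by (simp add: a_def Inv_def)
  have summable: "summable (\<lambda>n. a n * z ^ n)" for z
  proof (rule summable_comparison_test)
    show "summable (\<lambda>n. inverse (fact n) * norm z ^ n)" by (rule summable_exp)
    show "\<exists>N. \<forall>n\<ge>N. norm (a n * z ^ n) \<le> inverse (fact n) * norm z ^ n"
      using a_bound by (auto simp: norm_mult norm_power inverse_eq_divide intro!: mult_right_mono
          simp del: times_divide_eq_left)
  qed
  define f where "f z = (\<Sum>n. a n * z ^ n)" for z
  have f: "(\<lambda>n. a n * z ^ n) sums f z" for z
    unfolding f_def using summable by (rule summable_sums)
  \<comment> \<open>\<open>F m\<close> is exactly the partial sum of the series up to
    \<open>degree (F m)\<close>.\<close>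
  have lim: "(\<lambda>m. poly (F m) z) \<longlonglongrightarrow> f z" for z
  proof -
    have "(\<lambda>n. \<Sum>i\<le>n. a i * z ^ i) \<longlonglongrightarrow> f z" using f by (simp add: sums_def_le)
    from LIMSEQ_subseq_LIMSEQ[OF this mono] show ?thesis
      by (simp add: o_def poly_altdef a_eq)
  qed
  have value_eq: "f \<alpha> = poly (F j) \<alpha>" if "poly (g j) \<alpha> = 0" for j \<alpha>
  proof -
    have "poly (F m) \<alpha> = poly (F j) \<alpha>" if "m \<ge> j" for m
      using that
    proof (induction m rule: dec_induct)
      case (step m)
      thus ?case using F(2)[of m] \<open>poly (g j) \<alpha> = 0\<close> by (simp add: Step_def)
    qed simp
    hence "(\<lambda>m. poly (F m) \<alpha>) \<longlonglongrightarrow> poly (F j) \<alpha>"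
      by (intro tendsto_eventually eventually_sequentiallyI[of j])
    thus ?thesis using lim LIMSEQ_unique by blast
  qed

  have "a n \<in> \<rat>" for n
    using F(1)[of n] by (simp add: a_def Inv_def rational_poly_def)
  moreover have "infinite {n. a n \<noteq> 0}"
  proof -
    have "degree (F m) \<in> {n. a n \<noteq> 0}" for m
      using F(1)[of m] by (auto simp: a_eq[of _ m] Inv_def)
    hence "range (\<lambda>m. degree (F m)) \<subseteq> {n. a n \<noteq> 0}" by blast
    moreover have "infinite (range (\<lambda>m. degree (F m)))"
      using mono strict_mono_imp_inj_on by (metis finite_imageD infinite_UNIV_nat)
    ultimately show ?thesis using finite_subset by blast
  qed
  moreover have "f \<alpha> \<in> Qbar" if \<alpha>: "\<alpha> \<in> Qbar" for \<alpha>
  proof -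
    obtain j where "poly (g j) \<alpha> = 0" using \<alpha> Qbar_iff by blast
    thus ?thesis
      using \<alpha> F(1)[of j] value_eq[of j \<alpha>] algebraic_poly[of \<alpha> "F j"]
      by (simp add: Qbar_def Inv_def)
  qed
  moreover have "z \<in> Qbar" if z: "f z \<in> Qbar" for z
  proof -
    obtain j where j: "poly (g j) (f z) = 0" using z Qbar_iff by blast
    obtain N :: nat where "norm z \<le> real N" using real_arch_simple by blast
    \<comment> \<open>From step \<open>m\<close> on, the relative estimate applies to the polynomial
      \<open>g j\<close> and at the point \<open>z\<close>.\<close>
    define m where "m = max j N"
    have m: "m \<ge> j" "norm z \<le> real m" using \<open>norm z \<le> real N\<close> by (auto simp: m_def)
    \<comment> \<open>With \<alpha> = \<open>f z\<close>, a nonzero \<open>u m\<close> would keep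
      \<open>u k\<close> at least \<open>u m / 2\<close> forever, although \<open>u\<close> tends to
      0. So \<open>F m\<close> already takes the value \<open>f z\<close> at
      \<open>z\<close>.\<close>
    define u where "u k = norm (poly (F k) z - f z)" for k
    have "u k - u k / (real k + 2)\<^sup>2 \<le> u (Suc k)" if "k \<ge> m" for k
    proof -
      have "norm (poly (F (Suc k)) z - poly (F k) z) \<le> u k / (real k + 2)\<^sup>2"
        using F(2)[of k] j order_trans[OF m(1) that] order_trans[OF m(2), of "real k"] that
        unfolding Step_def u_def by simp
      moreover have "u k \<le> norm (poly (F (Suc k)) z - poly (F k) z) + u (Suc k)"
        unfolding u_def by norm
      ultimately show ?thesis by linarith
    qed
    hence "u m / 2 \<le> u k" if "k \<ge> m" for k
      using that by (intro half_le_of_slow_decrease) (auto simp: u_def)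
    moreover have "u \<longlonglongrightarrow> 0"
      unfolding u_def using lim[of z] by (simp add: LIM_zero_iff tendsto_norm_zero)
    ultimately have "u m / 2 \<le> 0" by (intro LIMSEQ_le_const) auto
    hence "poly (F m) z = f z" by (simp add: u_def)
    hence "poly (pcompose (g j) (F m)) z = 0" using j by (simp add: poly_pcompose)
    moreover have "pcompose (g j) (F m) \<noteq> 0"
      using g(2) F(1)[of m] pcompose_eq_0 unfolding Inv_def by blast
    moreover have "rational_poly (pcompose (g j) (F m))"
      using g(1) F(1)[of m] by (auto simp: Inv_def intro: rational_poly_pcompose)
    ultimately show ?thesis by (auto simp: Qbar_def algebraic_iff_rational_poly)
  qed
  moreover have "a \<noteq> A k" for k
  proof -
    \<comment> \<open>At this index \<open>a\<close> is the leading coefficient of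
      \<open>F (Suc k)\<close>, chosen in step \<open>k\<close> to differ from
      \<open>A k\<close>.\<close>
    have "a (degree (F (Suc k))) \<noteq> A k (degree (F (Suc k)))"
      using F(2)[of k] by (simp add: a_eq[of _ "Suc k"] Step_def)
    thus ?thesis by auto
  qed
  ultimately show ?thesis using f by blast
qed

section \<open>Uncountability by diagonalisation\<close>

theorem theorem1:
  shows "uncountable {f :: complex \<Rightarrow> complex.
           f holomorphic_on UNIV \<and>
           transcendental_on UNIV f \<and>
           (\<exists>a :: nat \<Rightarrow> complex. (\<forall>n. a n \<in> \<rat>) \<and> (\<forall>z. (\<lambda>n. a n * z ^ n) sums f z)) \<and>
           f ` Qbar \<subseteq> Qbar \<and>
           f -` Qbar \<subseteq> Qbar}"
    (is "uncountable ?S")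
proof
  assume S: "countable ?S"
  \<comment> \<open>Row \<open>k\<close> holds the Taylor coefficients at 0 of the
    \<open>k\<close>-th function in an enumeration of the set.\<close>
  define A where "A k n = (deriv ^^ n) (from_nat_into ?S k) 0 / fact n" for k n
  obtain f a where f: "\<And>n. a n \<in> \<rat>" "\<And>z. (\<lambda>n. a n * z ^ n) sums f z" "infinite {n. a n \<noteq> 0}"
      "f ` Qbar \<subseteq> Qbar" "f -` Qbar \<subseteq> Qbar" "\<And>k. a \<noteq> A k"
    using exists_function_preserving_Qbar[of A] by blast
  have "f \<in> ?S"
    using f everywhere_convergent_power_series(1)[OF f(2)] transcendental_onI[OF f(2,3)] by blast
  from from_nat_into_surj[OF S this] obtain k where k: "from_nat_into ?S k = f" ..
  have "a = A k"
    unfolding A_def k using everywhere_convergent_power_series(2)[OF f(2)] by auto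
  thus False using f(6) by blast
qed

end
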